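(* Let $\Bbbk$ be a field and let $\mathbb{Q}$ denote the $\Bbbk$-algebra generated by $y_1,y_2,x_1,x_2$ subject to the relations $$x_2x_1=-x_1x_2,\quad y_2y_1=-y_1y_2,\quad y_1x_1=x_1y_2,\quad y_2x_1=-x_1y_1,$$ $$y_1x_2=x_1y_1+x_2y_1+x_1y_2,\quad y_2x_2=x_1y_1-x_1y_2+x_2y_2.$$ Let $S\subset\Bbbk\{y_1,y_2,x_1,x_2\}$ be the set consisting of the six polynomials $$x_2x_1+x_1x_2,\quad y_2y_1+y_1y_2,\quad x_1y_2-y_1x_1,\quad x_1y_1+y_2x_1,$$ $$x_2y_1+y_1x_1-y_2x_1-y_1x_2,\quad x_2y_2-y_2x_1-y_1x_1-y_2x_2.$$ Then, with respect to the degree lexicographic order with $y_1\prec y_2\prec x_1\prec x_2$, the set $S$ is a Gröbner-Shirshov basis of the ideal $\mathrm{Id}(S)$, which is the ideal of defining relations of this algebra, i.e. $\mathbb{Q}=\Bbbk\{y_1,y_2,x_1,x_2\}/\mathrm{Id}(S)$.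
   Context: Here $\mathbb{Q}$ is the name of the algebra just defined, not the field of rational numbers. Let $X=\{y_1,y_2,x_1,x_2\}$, let $X^*$ be the free monoid of words in $X$, and let $\Bbbk\{X\}$ be the free associative unital $\Bbbk$-algebra on $X$ (noncommutative polynomials). $\mathrm{Id}(S)$ denotes the two-sided ideal of $\Bbbk\{X\}$ generated by $S$. The degree lexicographic order $\prec$ on $X^*$ compares words first by length and then, for equal length, lexicographically from left to right with $y_1\prec y_2\prec x_1\prec x_2$. For a nonzero $f\in\Bbbk\{X\}$, $\overline{f}$ denotes its leading (i.e. $\prec$-largest) word; $f$ is monic if the coefficient of $\overline{f}$ is $1$. For monic $f,g$: (i) if $w=\overline{f}a=b\overline{g}$ with $a,b\in X^*$ and $|\overline{f}|+|\overline{g}|>|w|$, then $(f,g)_w:=fa-bg$ is the intersection composition; (ii) if $w=\overline{f}=a\overline{g}b$ with $a,b\in X^*$, then $(f,g)_w:=f-agb$ is the inclusion composition. A composition $(f,g)_w$ is trivial modulo $S$ if $(f,g)_w=\sum_i\alpha_i a_is_ib_i$ (finite sum) with $\alpha_i\in\Bbbk$, $a_i,b_i\in X^*$, $s_i\in S$ and $a_i\overline{s_i}b_i\prec w$ for all $i$. A nonempty set $S$ of monic polynomials is a Gröbner-Shirshov basis of $\mathrm{Id}(S)$ if every composition $(f,g)_w$ with $f,g\in S$ is trivial modulo $S$. *)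

theory Defs
  imports "HOL-Library.Poly_Mapping" "HOL-Library.List_Lenlexorder"
    "HOL-Algebra.QuotRing" "HOL-Algebra.Module"
begin

section \<open>Noncommutative polynomials\<close>

text \<open>
  Words over an alphabet are lists. With concatenation as (noncommutative) addition they form the
  free monoid, and \<^typ>\<open>'a list \<Rightarrow>\<^sub>0 'k\<close>, with the convolution product of
  \<^theory>\<open>HOL-Library.Poly_Mapping\<close>, is the free associative unital algebra. The order on words is
  the one of \<^theory>\<open>HOL-Library.List_Lenlexorder\<close>: first by length, then lexicographically
  from left to right.
\<close>

instantiation list :: (type) monoid_add
begin

definition zero_list :: "'a list" where "0 = []"

definition plus_list :: "'a list \<Rightarrow> 'a list \<Rightarrow> 'a list" where "u + v = u @ v"

instance by standard (simp_all add: zero_list_def plus_list_def)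

end

type_synonym ('a, 'k) ncpoly = "'a list \<Rightarrow>\<^sub>0 'k"

definition word :: "'a list \<Rightarrow> ('a, 'k::field) ncpoly"
  where "word w = Poly_Mapping.single w 1"

definition scale :: "'k::field \<Rightarrow> ('a, 'k) ncpoly \<Rightarrow> ('a, 'k) ncpoly"
  where "scale c f = Poly_Mapping.single [] c * f"

lemma lookup_scale: "Poly_Mapping.lookup (scale c f) w = c * Poly_Mapping.lookup f w"
proof -
  have "scale c f = Poly_Mapping.map ((*) c) f"
    unfolding scale_def zero_list_def[symmetric] by (rule mult_map_scale_conv_mult[symmetric])
  then show ?thesis
    by (simp add: Poly_Mapping.map.rep_eq when_def)
qed

text \<open>The free algebra as a structure; the type of the alphabet is the set of generators.\<close>

definition free_algebra :: "('k::field, ('a, 'k) ncpoly) module"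
  where "free_algebra = \<lparr>carrier = UNIV, mult = (*), one = 1, zero = 0, add = (+), smult = scale\<rparr>"

lemma ring_free_algebra: "ring (free_algebra :: ('k::field, ('a, 'k) ncpoly) module)"
  by (unfold_locales)
    (auto simp: free_algebra_def algebra_simps Units_def intro: exI[of _ "- _"])

abbreviation ideal_of :: "('a, 'k::field) ncpoly set \<Rightarrow> ('a, 'k) ncpoly set"
  where "ideal_of S \<equiv> Idl\<^bsub>free_algebra\<^esub> S"


section \<open>Algebras given by generators and relations\<close>

definition quotient_algebra :: "('k, 'a) module \<Rightarrow> 'a set \<Rightarrow> ('k, 'a set) module"
  where "quotient_algebra A I =
    ring.extend (A Quot I) \<lparr>smult = (\<lambda>c C. \<Union>a\<in>C. I +>\<^bsub>A\<^esub> (c \<odot>\<^bsub>A\<^esub> a))\<rparr>"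

text \<open>A pair \<^term>\<open>(l, r)\<close> stands for the relation \<^term>\<open>l = r\<close>.\<close>

definition defining_ideal ::
    "(('a, 'k::field) ncpoly \<times> ('a, 'k) ncpoly) set \<Rightarrow> ('a, 'k) ncpoly set"
  where "defining_ideal R = ideal_of {l - r | l r. (l, r) \<in> R}"

definition presented_algebra ::
    "(('a, 'k::field) ncpoly \<times> ('a, 'k) ncpoly) set \<Rightarrow> ('k, ('a, 'k) ncpoly set) module"
  where "presented_algebra R = quotient_algebra free_algebra (defining_ideal R)"


section \<open>Groebner-Shirshov bases\<close>

definition leading_word :: "('a::linorder, 'k::field) ncpoly \<Rightarrow> 'a list"
  where "leading_word f = Max (Poly_Mapping.keys f)"

definition monic :: "('a::linorder, 'k::field) ncpoly \<Rightarrow> bool"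
  where "monic f \<longleftrightarrow> f \<noteq> 0 \<and> Poly_Mapping.lookup f (leading_word f) = 1"

text \<open>\<^term>\<open>is_composition f g w h\<close>: the polynomial \<^term>\<open>h\<close> is a composition of
  \<^term>\<open>f\<close> and \<^term>\<open>g\<close> with respect to the word \<^term>\<open>w\<close>.\<close>

inductive is_composition ::
    "('a::linorder, 'k::field) ncpoly \<Rightarrow> ('a, 'k) ncpoly \<Rightarrow> 'a list \<Rightarrow> ('a, 'k) ncpoly \<Rightarrow> bool"
  for f g where
  intersection:
    "\<lbrakk>w = leading_word f @ a; w = b @ leading_word g;
      length (leading_word f) + length (leading_word g) > length w\<rbrakk>
     \<Longrightarrow> is_composition f g w (f * word a - word b * g)"
| inclusion:
    "\<lbrakk>w = leading_word f; w = a @ leading_word g @ b\<rbrakk>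
     \<Longrightarrow> is_composition f g w (f - word a * g * word b)"

definition trivial_modulo ::
    "('a::linorder, 'k::field) ncpoly set \<Rightarrow> 'a list \<Rightarrow> ('a, 'k) ncpoly \<Rightarrow> bool"
  where "trivial_modulo S w h \<longleftrightarrow>
    (\<exists>ts :: ('k \<times> 'a list \<times> ('a, 'k) ncpoly \<times> 'a list) list.
      (\<forall>(\<alpha>, a, s, b) \<in> set ts. s \<in> S \<and> a @ leading_word s @ b < w) \<and>
      h = (\<Sum>(\<alpha>, a, s, b) \<leftarrow> ts. scale \<alpha> (word a * s * word b)))"

definition groebner_shirshov_basis :: "('a::linorder, 'k::field) ncpoly set \<Rightarrow> bool"
  where "groebner_shirshov_basis S \<longleftrightarrow>
    S \<noteq> {} \<and> (\<forall>s\<in>S. monic s) \<and>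
    (\<forall>f\<in>S. \<forall>g\<in>S. \<forall>w h. is_composition f g w h \<longrightarrow> trivial_modulo S w h)"


section \<open>The algebra\<close>

datatype gen = Y1 | Y2 | X1 | X2

fun gen_rank :: "gen \<Rightarrow> nat" where
  "gen_rank Y1 = 0" | "gen_rank Y2 = 1" | "gen_rank X1 = 2" | "gen_rank X2 = 3"

instantiation gen :: linorder
begin

definition less_eq_gen :: "gen \<Rightarrow> gen \<Rightarrow> bool" where "g \<le> h \<longleftrightarrow> gen_rank g \<le> gen_rank h"

definition less_gen :: "gen \<Rightarrow> gen \<Rightarrow> bool" where "g < h \<longleftrightarrow> gen_rank g < gen_rank h"

instance
proof
  fix g h :: gen
  show "g = h" if "g \<le> h" "h \<le> g"
    using that by (cases g; cases h) (simp_all add: less_eq_gen_def)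
qed (auto simp: less_eq_gen_def less_gen_def)

end

abbreviation y1 :: "(gen, 'k::field) ncpoly" where "y1 \<equiv> word [Y1]"
abbreviation y2 :: "(gen, 'k::field) ncpoly" where "y2 \<equiv> word [Y2]"
abbreviation x1 :: "(gen, 'k::field) ncpoly" where "x1 \<equiv> word [X1]"
abbreviation x2 :: "(gen, 'k::field) ncpoly" where "x2 \<equiv> word [X2]"

definition Q_relations :: "((gen, 'k::field) ncpoly \<times> (gen, 'k) ncpoly) set"
  where "Q_relations =
    {(x2 * x1, - (x1 * x2)),
     (y2 * y1, - (y1 * y2)),
     (y1 * x1, x1 * y2),
     (y2 * x1, - (x1 * y1)),
     (y1 * x2, x1 * y1 + x2 * y1 + x1 * y2),
     (y2 * x2, x1 * y1 - x1 * y2 + x2 * y2)}"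

definition Q_algebra :: "('k::field, (gen, 'k) ncpoly set) module"
  where "Q_algebra = presented_algebra Q_relations"

definition Q_basis :: "(gen, 'k::field) ncpoly set"
  where "Q_basis =
    {x2 * x1 + x1 * x2,
     y2 * y1 + y1 * y2,
     x1 * y2 - y1 * x1,
     x1 * y1 + y2 * x1,
     x2 * y1 + y1 * x1 - y2 * x1 - y1 * x2,
     x2 * y2 - y2 * x1 - y1 * x1 - y2 * x2}"

end

theory Submission
  imports Defs
begin

text \<open>
  The six leading words of \<^const>\<open>Q_basis\<close> are distinct and have length two. Two such words
  can only overlap completely, which makes both polynomials equal and their composition zero, or
  in a single letter, which puts the composition on a word of length three
  (\<open>is_composition_quadratic\<close>). Since every leading word except \<open>x2 x1\<close> ends in \<open>y1\<close> or
  \<open>y2\<close>, and \<open>y2 y1\<close> is the only one to begin with one of these letters, the overlaps are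
  just \<open>x2 x1 y1\<close>, \<open>x2 x1 y2\<close>, \<open>x1 y2 y1\<close> and \<open>x2 y2 y1\<close>. On each of them the composition
  rewrites to zero; collecting the rewriting steps displays it as a signed sum of one-sided
  multiples of basis elements, an identity in the free ring (\<open>trivial_x2x1y1\<close> to \<open>trivial_x2y2y1\<close>).

  The four relations for \<open>x2 x1\<close>, \<open>y2 y1\<close>, \<open>x1 y2\<close> and \<open>x1 y1\<close> are basis elements up to sign, and
  using the last two of them to eliminate \<open>x1 y1\<close> and \<open>x1 y2\<close> turns the remaining two relations
  into the remaining two basis elements, again up to sign. So both sets generate the same additive group, a fortiori
  the same ideal (\<open>ideal_of_Q_basis\<close>).
\<close>

section \<open>Words and leading words\<close>

lemma word_append: "word (u @ v) = word u * word v"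
  by (simp add: word_def mult_single plus_list_def)

lemma word_Nil: "word [] = 1"
  by (simp add: word_def zero_list_def[symmetric])

lemma word_Cons2: "word (x # y # u) = word [x] * word (y # u)"
  using word_append[of "[x]" "y # u"] by simp

lemma keys_word: "Poly_Mapping.keys (word w :: ('a, 'k::field) ncpoly) = {w}"
  by (simp add: word_def)

text \<open>
  The degree lexicographic order is not compatible with comparing heads for words of different
  length; for equal lengths it is, and this decides all comparisons of concrete homogeneous words.
\<close>

lemma Cons_less_Cons_same_length:
  fixes x y :: "'a::linorder"
  assumes "length u = length v"
  shows "x # u < y # v \<longleftrightarrow> x < y \<or> x = y \<and> u < v"
  using assms by (auto simp: list_less_def lenlex_conv)

lemma leading_word_word_add:
  fixes r :: "('a::linorder, 'k::field) ncpoly"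
  assumes "\<And>v. v \<in> Poly_Mapping.keys r \<Longrightarrow> v < w"
  shows "leading_word (word w + r) = w" and "monic (word w + r)"
proof -
  have "w \<notin> Poly_Mapping.keys r"
    using assms by blast
  then have coeff: "Poly_Mapping.lookup (word w + r) w = 1"
    by (simp add: lookup_add word_def in_keys_iff)
  moreover have "v \<le> w" if "v \<in> Poly_Mapping.keys (word w + r)" for v
    using that Poly_Mapping.keys_add[of "word w" r] assms by (auto simp: keys_word less_imp_le)
  ultimately show lw: "leading_word (word w + r) = w"
    unfolding leading_word_def by (intro Max_eqI) (auto simp: in_keys_iff)
  show "monic (word w + r)"
    unfolding monic_def lw using coeff by auto
qed

section \<open>Compositions trivial modulo a set\<close>

lemma trivial_modulo_zero: "trivial_modulo S w 0"
  unfolding trivial_modulo_def by (intro exI[of _ "[]"]) simp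

lemma trivial_modulo_add:
  assumes "trivial_modulo S w g" "trivial_modulo S w h"
  shows "trivial_modulo S w (g + h)"
proof -
  from assms obtain ts us where
    "\<forall>(\<alpha>, a, s, b) \<in> set ts. s \<in> S \<and> a @ leading_word s @ b < w"
    "g = (\<Sum>(\<alpha>, a, s, b) \<leftarrow> ts. scale \<alpha> (word a * s * word b))"
    "\<forall>(\<alpha>, a, s, b) \<in> set us. s \<in> S \<and> a @ leading_word s @ b < w"
    "h = (\<Sum>(\<alpha>, a, s, b) \<leftarrow> us. scale \<alpha> (word a * s * word b))"
    unfolding trivial_modulo_def by blast
  then show ?thesis
    unfolding trivial_modulo_def by (intro exI[of _ "ts @ us"]) auto
qed

lemma trivial_modulo_scale_mult:
  assumes "s \<in> S" "a @ leading_word s @ b < w"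
  shows "trivial_modulo S w (scale \<alpha> (word a * s * word b))"
  unfolding trivial_modulo_def using assms by (intro exI[of _ "[(\<alpha>, a, s, b)]"]) simp

lemma scale_1: "scale 1 f = f" and scale_minus_1: "scale (- 1) f = - f"
  by (auto intro!: poly_mapping_eqI simp: lookup_scale)

lemma trivial_modulo_one_sided:
  assumes "s \<in> S"
  shows "u @ leading_word s < w \<Longrightarrow> trivial_modulo S w (word u * s)"
    and "u @ leading_word s < w \<Longrightarrow> trivial_modulo S w (- (word u * s))"
    and "leading_word s @ u < w \<Longrightarrow> trivial_modulo S w (s * word u)"
    and "leading_word s @ u < w \<Longrightarrow> trivial_modulo S w (- (s * word u))"
  using trivial_modulo_scale_mult[OF assms, of u "[]" w 1]
    trivial_modulo_scale_mult[OF assms, of u "[]" w "- 1"]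
    trivial_modulo_scale_mult[OF assms, of "[]" u w 1]
    trivial_modulo_scale_mult[OF assms, of "[]" u w "- 1"]
  by (simp_all add: scale_1 scale_minus_1 word_Nil)

text \<open>
  An overlap in two letters, and in particular every inclusion, makes the leading words equal and
  hence \<open>f = g\<close>, so that the composition is \<open>f - f\<close>. This leaves the overlaps in one letter.
\<close>

lemma is_composition_quadratic:
  assumes comp: "is_composition f g w h"
    and len: "length (leading_word f) = 2" "length (leading_word g) = 2"
    and inj: "leading_word f = leading_word g \<longrightarrow> f = g"
  obtains "h = 0"
  | u v z where "leading_word f = [u, v]" "leading_word g = [v, z]"
      "w = [u, v, z]" "h = f * word [z] - word [u] * g"
proof -
  obtain u v u' v' where lw: "leading_word f = [u, v]" "leading_word g = [u', v']"
    using len by (auto simp: length_Suc_conv numeral_2_eq_2)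
  from comp show thesis
  proof cases
    case (intersection a b)
    show thesis
    proof (cases a)
      case Nil
      with intersection lw inj have "b = []" "f = g"
        by (auto simp: Cons_eq_append_conv)
      with intersection Nil that(1) show thesis
        by (simp add: word_Nil)
    next
      case (Cons z a')
      with intersection lw have "a' = []" "b = [u]" "u' = v" "v' = z" "w = [u, v, z]"
        by (auto simp: Cons_eq_append_conv append_eq_Cons_conv)
      with that(2) intersection Cons lw show thesis
        by simp
    qed
  next
    case (inclusion a b)
    with lw inj have "a = []" "b = []" "f = g"
      by (auto simp: Cons_eq_append_conv append_eq_Cons_conv)
    with inclusion that(1) show thesis
      by (simp add: word_Nil)
  qed
qed

section \<open>The six relations\<close>

text \<open>Each polynomial is named after its leading word.\<close>

definition q_x2x1 :: "(gen, 'k::field) ncpoly" where "q_x2x1 = x2 * x1 + x1 * x2"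
definition q_y2y1 :: "(gen, 'k::field) ncpoly" where "q_y2y1 = y2 * y1 + y1 * y2"
definition q_x1y2 :: "(gen, 'k::field) ncpoly" where "q_x1y2 = x1 * y2 - y1 * x1"
definition q_x1y1 :: "(gen, 'k::field) ncpoly" where "q_x1y1 = x1 * y1 + y2 * x1"
definition q_x2y1 :: "(gen, 'k::field) ncpoly"
  where "q_x2y1 = x2 * y1 + y1 * x1 - y2 * x1 - y1 * x2"
definition q_x2y2 :: "(gen, 'k::field) ncpoly"
  where "q_x2y2 = x2 * y2 - y2 * x1 - y1 * x1 - y2 * x2"

lemmas q_defs = q_x2x1_def q_y2y1_def q_x1y2_def q_x1y1_def q_x2y1_def q_x2y2_def

lemma Q_basis_eq: "Q_basis = {q_x2x1, q_y2y1, q_x1y2, q_x1y1, q_x2y1, q_x2y2}"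
  by (simp add: Q_basis_def q_defs)

lemma Q_basis_leading:
  shows "leading_word (q_x2x1 :: (gen, 'k::field) ncpoly) = [X2, X1] \<and> monic (q_x2x1 :: (gen, 'k) ncpoly)"
    and "leading_word (q_y2y1 :: (gen, 'k) ncpoly) = [Y2, Y1] \<and> monic (q_y2y1 :: (gen, 'k) ncpoly)"
    and "leading_word (q_x1y2 :: (gen, 'k) ncpoly) = [X1, Y2] \<and> monic (q_x1y2 :: (gen, 'k) ncpoly)"
    and "leading_word (q_x1y1 :: (gen, 'k) ncpoly) = [X1, Y1] \<and> monic (q_x1y1 :: (gen, 'k) ncpoly)"
    and "leading_word (q_x2y1 :: (gen, 'k) ncpoly) = [X2, Y1] \<and> monic (q_x2y1 :: (gen, 'k) ncpoly)"
    and "leading_word (q_x2y2 :: (gen, 'k) ncpoly) = [X2, Y2] \<and> monic (q_x2y2 :: (gen, 'k) ncpoly)"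
proof -
  have split: "leading_word f = w \<and> monic f"
    if "f = word w + r" "Poly_Mapping.keys r \<subseteq> V" "\<forall>v\<in>V. v < w"
    for f r :: "(gen, 'k) ncpoly" and w V
    using leading_word_word_add[of r w] that by blast
  note less = Cons_less_Cons_same_length less_gen_def
  note keys = keys_word subset_iff in_keys_iff lookup_add lookup_minus word_def lookup_single when_def
  show "leading_word (q_x2x1 :: (gen, 'k) ncpoly) = [X2, X1] \<and> monic (q_x2x1 :: (gen, 'k) ncpoly)"
    by (rule split[where r = "word [X1, X2]" and V = "{[X1, X2]}"])
      (simp add: q_defs word_Cons2, auto simp: less keys split: if_splits)
  show "leading_word (q_y2y1 :: (gen, 'k) ncpoly) = [Y2, Y1] \<and> monic (q_y2y1 :: (gen, 'k) ncpoly)"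
    by (rule split[where r = "word [Y1, Y2]" and V = "{[Y1, Y2]}"])
      (simp add: q_defs word_Cons2, auto simp: less keys split: if_splits)
  show "leading_word (q_x1y2 :: (gen, 'k) ncpoly) = [X1, Y2] \<and> monic (q_x1y2 :: (gen, 'k) ncpoly)"
    by (rule split[where r = "- word [Y1, X1]" and V = "{[Y1, X1]}"])
      (simp add: q_defs word_Cons2, auto simp: less keys split: if_splits)
  show "leading_word (q_x1y1 :: (gen, 'k) ncpoly) = [X1, Y1] \<and> monic (q_x1y1 :: (gen, 'k) ncpoly)"
    by (rule split[where r = "word [Y2, X1]" and V = "{[Y2, X1]}"])
      (simp add: q_defs word_Cons2, auto simp: less keys split: if_splits)
  show "leading_word (q_x2y1 :: (gen, 'k) ncpoly) = [X2, Y1] \<and> monic (q_x2y1 :: (gen, 'k) ncpoly)"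
    by (rule split[where r = "word [Y1, X1] - word [Y2, X1] - word [Y1, X2]"
          and V = "{[Y1, X1], [Y2, X1], [Y1, X2]}"])
      (simp add: q_defs word_Cons2, auto simp: less keys split: if_splits)
  show "leading_word (q_x2y2 :: (gen, 'k) ncpoly) = [X2, Y2] \<and> monic (q_x2y2 :: (gen, 'k) ncpoly)"
    by (rule split[where r = "- word [Y2, X1] - word [Y1, X1] - word [Y2, X2]"
          and V = "{[Y2, X1], [Y1, X1], [Y2, X2]}"])
      (simp add: q_defs word_Cons2, auto simp: less keys split: if_splits)
qed

lemmas leading_word_q = Q_basis_leading[THEN conjunct1]
lemmas monic_q = Q_basis_leading[THEN conjunct2]

section \<open>The four ambiguities\<close>

text \<open>
  Each equation below is the trace of rewriting both terms of the composition to normal form: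
  every summand is one use of a relation, with its sign, and the normal forms cancel. A summand
  \<open>- f\<close> is always added, never subtracted, so that \<open>trivial_modulo_add\<close> decomposes the sum.
  Each multiple of a relation has a leading word of length three below the overlap, because
  it arises by rewriting a smaller word.
\<close>

lemmas trivial_modulo_q =
  trivial_modulo_one_sided[where S = Q_basis] trivial_modulo_add

lemmas q_side_conditions =
  Q_basis_eq leading_word_q Cons_less_Cons_same_length less_gen_def

lemma trivial_x2x1y1:
  "trivial_modulo Q_basis [X2, X1, Y1] (q_x2x1 * y1 - x2 * (q_x1y1 :: (gen, 'k::field) ncpoly))"
proof -
  have "q_x2x1 * y1 - x2 * (q_x1y1 :: (gen, 'k) ncpoly) =
      x1 * q_x2y1 + - (q_x1y1 * x1) + q_x1y2 * x1 + q_x1y1 * x2 + - (q_x2y2 * x1)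
      + - (y2 * q_x2x1)"
    by (simp add: q_defs algebra_simps)
  then show ?thesis
    by (simp only:, intro trivial_modulo_q; simp add: q_side_conditions)
qed

lemma trivial_x2x1y2:
  "trivial_modulo Q_basis [X2, X1, Y2] (q_x2x1 * y2 - x2 * (q_x1y2 :: (gen, 'k::field) ncpoly))"
proof -
  have "q_x2x1 * y2 - x2 * (q_x1y2 :: (gen, 'k) ncpoly) =
      x1 * q_x2y2 + q_x1y2 * x1 + q_x1y1 * x1 + q_x1y2 * x2 + q_x2y1 * x1 + y1 * q_x2x1"
    by (simp add: q_defs algebra_simps)
  then show ?thesis
    by (simp only:, intro trivial_modulo_q; simp add: q_side_conditions)
qed

lemma trivial_x1y2y1:
  "trivial_modulo Q_basis [X1, Y2, Y1] (q_x1y2 * y1 - x1 * (q_y2y1 :: (gen, 'k::field) ncpoly))"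
proof -
  have "q_x1y2 * y1 - x1 * (q_y2y1 :: (gen, 'k) ncpoly) =
      - (y1 * q_x1y1) + - (q_x1y1 * y2) + y2 * q_x1y2 + q_y2y1 * x1"
    by (simp add: q_defs algebra_simps)
  then show ?thesis
    by (simp only:, intro trivial_modulo_q; simp add: q_side_conditions)
qed

lemma trivial_x2y2y1:
  "trivial_modulo Q_basis [X2, Y2, Y1] (q_x2y2 * y1 - x2 * (q_y2y1 :: (gen, 'k::field) ncpoly))"
proof -
  have "q_x2y2 * y1 - x2 * (q_y2y1 :: (gen, 'k) ncpoly) =
      - (y2 * q_x1y1) + - (y1 * q_x1y1) + - (y2 * q_x2y1) + - (q_y2y1 * x2)
      + - (q_x2y1 * y2) + y1 * q_x1y2 + - (y2 * q_x1y2) + - (y1 * q_x2y2)"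
    by (simp add: q_defs algebra_simps)
  then show ?thesis
    by (simp only:, intro trivial_modulo_q; simp add: q_side_conditions)
qed

lemma groebner_shirshov_basis_Q: "groebner_shirshov_basis (Q_basis :: (gen, 'k::field) ncpoly set)"
  unfolding groebner_shirshov_basis_def
proof (intro conjI ballI allI impI)
  show "(Q_basis :: (gen, 'k) ncpoly set) \<noteq> {}"
    by (simp add: Q_basis_eq)
  show "monic s" if "s \<in> Q_basis" for s :: "(gen, 'k) ncpoly"
    using that monic_q by (auto simp: Q_basis_eq)
  fix f g h :: "(gen, 'k) ncpoly" and w
  assume f: "f \<in> Q_basis" and g: "g \<in> Q_basis" and comp: "is_composition f g w h"
  have len: "length (leading_word s) = 2" if "s \<in> Q_basis" for s :: "(gen, 'k) ncpoly"
    using that by (auto simp: Q_basis_eq leading_word_q)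
  have inj: "leading_word f = leading_word g \<longrightarrow> f = g"
    using f g by (auto simp: Q_basis_eq leading_word_q)
  show "trivial_modulo Q_basis w h"
  proof (cases rule: is_composition_quadratic[OF comp len[OF f] len[OF g] inj])
    case 1
    then show ?thesis
      by (simp add: trivial_modulo_zero)
  next
    case (2 u v z)
    then show ?thesis
      using f g unfolding Q_basis_eq
      by (elim insertE emptyE)
        (auto simp: leading_word_q simp flip: Q_basis_eq
          intro: trivial_x2x1y1 trivial_x2x1y2 trivial_x1y2y1 trivial_x2y2y1)
  qed
qed

section \<open>The ideal of defining relations\<close>

lemma ideal_ideal_of: "ideal (ideal_of S) (free_algebra :: ('k::field, ('a, 'k) ncpoly) module)"
  by (rule ring.genideal_ideal[OF ring_free_algebra]) (simp add: free_algebra_def)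

lemma ideal_of_add: "f \<in> ideal_of S \<Longrightarrow> g \<in> ideal_of S \<Longrightarrow> f + g \<in> ideal_of S"
  for f :: "('a, 'k::field) ncpoly"
  using additive_subgroup.a_closed[OF ideal.axioms(1)[OF ideal_ideal_of]]
  by (simp add: free_algebra_def)

lemma ideal_of_uminus:
  fixes f :: "('a, 'k::field) ncpoly"
  assumes "f \<in> ideal_of S"
  shows "- f \<in> ideal_of S"
proof -
  have "(- 1) \<otimes>\<^bsub>free_algebra\<^esub> f \<in> ideal_of S"
    by (rule ideal.I_l_closed[OF ideal_ideal_of assms]) (simp add: free_algebra_def)
  then show ?thesis
    by (simp add: free_algebra_def)
qed

lemma ideal_of_base: "f \<in> S \<Longrightarrow> f \<in> ideal_of S" for f :: "('a, 'k::field) ncpoly"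
  using ring.genideal_self[OF ring_free_algebra, of S] by (auto simp: free_algebra_def)

lemma ideal_of_subset:
  fixes S T :: "('a, 'k::field) ncpoly set"
  shows "S \<subseteq> ideal_of T \<Longrightarrow> ideal_of S \<subseteq> ideal_of T"
  by (rule ring.genideal_minimal[OF ring_free_algebra ideal_ideal_of])

lemma ideal_of_Q_basis:
  "ideal_of (Q_basis :: (gen, 'k::field) ncpoly set) = defining_ideal Q_relations"
proof -
  \<comment> \<open>The two relations that are not basis elements up to sign, before \<open>x1 y1\<close> and \<open>x1 y2\<close> are
    eliminated from them.\<close>
  define r_y1x2 r_y2x2 :: "(gen, 'k) ncpoly"
    where "r_y1x2 = y1 * x2 - (x1 * y1 + x2 * y1 + x1 * y2)"
      and "r_y2x2 = y2 * x2 - (x1 * y1 - x1 * y2 + x2 * y2)"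
  define P where "P = {q_x2x1, q_y2y1, - q_x1y2, q_x1y1, r_y1x2, r_y2x2}"
  have "{l - r | l r. (l, r) \<in> (Q_relations :: ((gen, 'k) ncpoly \<times> _) set)} =
      (\<lambda>(l, r). l - r) ` Q_relations"
    by (auto simp: image_iff)
  also have "\<dots> = P"
    by (simp add: P_def Q_relations_def q_defs r_y1x2_def r_y2x2_def add.commute)
  finally have defining: "defining_ideal Q_relations = ideal_of P"
    by (simp add: defining_ideal_def)
  have "r_y1x2 = - q_x2y1 + - q_x1y1 + - q_x1y2" "r_y2x2 = - q_x2y2 + - q_x1y1 + q_x1y2"
    by (simp_all add: r_y1x2_def r_y2x2_def q_defs)
  moreover have "q_x2x1 \<in> ideal_of Q_basis" "q_y2y1 \<in> ideal_of Q_basis"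
    "q_x1y2 \<in> ideal_of Q_basis" "q_x1y1 \<in> ideal_of Q_basis"
    "q_x2y1 \<in> ideal_of Q_basis" "q_x2y2 \<in> ideal_of Q_basis"
    by (auto intro!: ideal_of_base simp: Q_basis_eq)
  ultimately have "P \<subseteq> ideal_of Q_basis"
    unfolding P_def by (metis ideal_of_add ideal_of_uminus insert_subset empty_subsetI)
  moreover have "Q_basis \<subseteq> ideal_of P"
  proof -
    have "q_x1y2 = - (- q_x1y2)" "q_x2y1 = - r_y1x2 + - q_x1y1 + - q_x1y2"
      "q_x2y2 = - r_y2x2 + - q_x1y1 + q_x1y2"
      by (simp_all add: r_y1x2_def r_y2x2_def q_defs)
    moreover have "- q_x1y2 \<in> ideal_of P" "q_x1y1 \<in> ideal_of P" "q_x2x1 \<in> ideal_of P"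
      "q_y2y1 \<in> ideal_of P" "r_y1x2 \<in> ideal_of P" "r_y2x2 \<in> ideal_of P"
      by (auto intro!: ideal_of_base simp: P_def)
    ultimately show ?thesis
      unfolding Q_basis_eq by (metis ideal_of_add ideal_of_uminus insert_subset empty_subsetI)
  qed
  ultimately show ?thesis
    unfolding defining by (intro subset_antisym ideal_of_subset)
qed

theorem mainTheorem8:
  shows "groebner_shirshov_basis (Q_basis :: (gen, 'k::field) ncpoly set)
    \<and> ideal_of (Q_basis :: (gen, 'k) ncpoly set) = defining_ideal Q_relations
    \<and> (Q_algebra :: ('k, (gen, 'k) ncpoly set) module) = quotient_algebra free_algebra (ideal_of Q_basis)"
  by (simp add: groebner_shirshov_basis_Q ideal_of_Q_basis Q_algebra_def presented_algebra_def)

end
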